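(* The $\mathbb{N}^*$-current-preserving operad $\mathcal{B}^\lambda$ is, for $\lambda=0$, the current-preserving operad $(\mathcal{B}^0)^{\mathbb{N}^*}$ naturally associated with the ordinary operad $\mathcal{B}^0$, and, for $\lambda=1$, the current-preserving operad $Brace^{\mathbb{N}^*}$ naturally associated with the ordinary operad $Brace$.
   Context: $K$ is a field of characteristic zero; $\mathbb{N}^*=\{1,2,3,\dots\}$ with addition; $0^0=1$. Operads are in species form: vector spaces $\mathcal{P}_A$ for finite nonempty sets $A$, functorial in bijections, with partial compositions $\circ_v:\mathcal{P}_A\times\mathcal{P}_B\to\mathcal{P}_{(A\setminus\{v\})\amalg B}$, $v\in A$, satisfying nested and disjoint associativity, unit and equivariance axioms. A $G$-current-preserving operad ($G$ a commutative semigroup, written additively) is an operad with $\mathcal{P}_A=\prod_{W:A\to G}\mathcal{P}_{A,W}$, with $\mathcal{P}_{A,W}.\sigma=\mathcal{P}_{A,W\circ\sigma}$ for $\sigma\in\mathrm{Aut}A$, such that $\circ_v$ maps $\mathcal{P}_{A,W}\otimes\mathcal{P}_{B,X}$ to $\mathcal{P}_{(A\setminus\{v\})\amalg B,W\amalg X}$ with image zero if $\sum_{b\in B}X(b)\neq W(v)$ (here $W\amalg X$ is $W$ on $A\setminus\{v\}$ and $X$ on $B$). Associated current-preserving operad. For an ordinary operad $\mathcal{P}$, the $G$-current-preserving operad $\mathcal{P}^G$ is $\mathcal{P}^G_A=\prod_{W:A\to G}\mathcal{P}_{A,W}$, each $\mathcal{P}_{A,W}$ being a copy of $\mathcal{P}_A$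 with elements written $(\alpha,W)$, with $(\alpha,W)\circ_a^G(\beta,X)=(\alpha\circ_a\beta,W\amalg X)$ if $\sum_{b\in B}X(b)=W(a)$, and $0$ otherwise. Trees. A planar rooted tree is a rooted tree in which the children of each vertex are totally ordered from left to right; $B_+(r,T_1\cdots T_k)$ is the tree with root $r$ and branches $T_1,\dots,T_k$ from left to right. A tree is labelled by $A$ via a bijection from its vertex set onto $A$. $\mathcal{PRT}(A)$ is the vector space spanned by planar rooted trees labelled by $A$. $E(S,v)$ is the set of edges joining $v$ to its children, ordered from left to right. An angle of $T$ is a pair of a vertex $s$ and a sector around $s$ cut out by $T$ in a small disk centred at $s$; a vertex with $k$ children has $k+1$ angles $(s,0),\dots,(s,k)$ from left to right. $Ang(T)$ is totally ordered: for $T=B_+(r,T_1\cdots T_k)$, $(r,0)<Ang(T_1)<(r,1)<\cdots<Ang(T_k)<(r,k)$, recursively. $Ang^0(T)$ is the set of angles at the root. "Increasing" means weakly increasing. For increasing $f:E(S,v)\to Ang(T)$, $S\diamond_v^fT$ is obtained by replacing $v$ by $T$, plugging each edge $a\in E(S,v)$ with its branch into the angle $f(a)$ (edges plugged into the same angle keep their order), the edge going down from $v$, if any, now going down from the root of $T$ at the same position. Ordinary operads. $Brace$ is the species $A\mapsto\mathcal{PRT}(A)$ with $S\diamond_vT=\sum_fS\diamond_v^fT$ over all increasing $f:E(S,v)\to Ang(T)$. $\mathcal{B}^0$ as an ordinary operad is the same species with $S\diamond_vT=\sum_fS\diamond_v^fT$ over all increasing $f:E(S,v)\to Ang^0(T)$.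 In both the unit is the one-vertex tree. The current-preserving operad $\mathcal{B}^\lambda$, $\lambda\in K$. A weighted tree carries a weight function $W$ from its vertices to $\mathbb{N}^*$; $|v|=W(v)$, $|T|=\sum_vW(v)$, $d(T)=\sum_vW(v)h(v)$ with $h(v)$ the number of edges from $v$ to the root. $\mathcal{B}_{A,W}$ is spanned by planar rooted trees labelled by $A$ with weight function $W$, and $\mathcal{B}_A=\prod_{W:A\to\mathbb{N}^*}\mathcal{B}_{A,W}$. For weighted trees, with weights inherited under substitution, $S\diamond_{v,\lambda}T=\sum_f\lambda^{d(S\diamond_v^fT)-d(S\diamond_v^{f_0}T)}S\diamond_v^fT$ (sum over increasing $f:E(S,v)\to Ang(T)$) if $|T|=|v|$, and $0$ otherwise, where $f_0:E(S,v)\to Ang^0(T)$ is any increasing map (the energy $d(S\diamond_v^{f_0}T)$ does not depend on its choice). The unit is $\sum_{n\ge1}\bullet_n$, with $\bullet_n$ the one-vertex tree of weight $n$. In the statement, a weighted tree with underlying labelled tree $T$ and weight function $W$ is identified with the element $(T,W)$. *)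

theory Defs
  imports
    Complex_Main
    "HOL-Library.FuncSet"
    "HOL-Library.Function_Algebras"
    "HOL-Library.Poly_Mapping"
begin

section \<open>Free vector spaces\<close>

text \<open>\<^typ>\<open>'b \<Rightarrow>\<^sub>0 'k\<close> is the vector space with basis \<^typ>\<open>'b\<close>; the basis vector of \<open>b\<close> is
  \<open>Poly_Mapping.single b 1\<close>.\<close>

definition scale :: "'k::field \<Rightarrow> ('b \<Rightarrow>\<^sub>0 'k) \<Rightarrow> ('b \<Rightarrow>\<^sub>0 'k)" where
  "scale c x = Poly_Mapping.map (\<lambda>a. c * a) x"

definition span_of :: "'b set \<Rightarrow> ('b \<Rightarrow>\<^sub>0 'k::field) set" where
  "span_of X = {x. Poly_Mapping.keys x \<subseteq> X}"

definition lin_ext :: "('b \<Rightarrow> ('c \<Rightarrow>\<^sub>0 'k)) \<Rightarrow> ('b \<Rightarrow>\<^sub>0 'k::field) \<Rightarrow> ('c \<Rightarrow>\<^sub>0 'k)" where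
  "lin_ext f x = (\<Sum>b\<in>Poly_Mapping.keys x. scale (Poly_Mapping.lookup x b) (f b))"

definition bilin_ext ::
  "('a \<Rightarrow> 'b \<Rightarrow> ('c \<Rightarrow>\<^sub>0 'k)) \<Rightarrow> ('a \<Rightarrow>\<^sub>0 'k::field) \<Rightarrow> ('b \<Rightarrow>\<^sub>0 'k) \<Rightarrow> ('c \<Rightarrow>\<^sub>0 'k)" where
  "bilin_ext f x y = lin_ext (\<lambda>a. lin_ext (f a) y) x"


section \<open>Structure maps of operads and of current-preserving operads\<close>

text \<open>
  Finite nonempty sets are taken inside an arbitrary type \<^typ>\<open>'v\<close>.

  \<^item> \<open>op_space P A\<close> is (the underlying set of) \<open>P\<^sub>A\<close>; addition is that of the type \<^typ>\<open>'m\<close>.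
  \<^item> \<open>op_act P A' \<sigma>\<close> is the right action \<open>x \<mapsto> x.\<sigma>\<close>, from \<open>P\<^sub>A\<close> to \<open>P\<^sub>A\<^sub>'\<close>, of a bijection \<open>\<sigma>\<close> from \<open>A'\<close> to \<open>A\<close>.
  \<^item> \<open>op_comp P A v B\<close> is \<open>\<circ>\<^sub>v\<close> from \<open>P\<^sub>A \<times> P\<^sub>B\<close> to the space of \<open>(A - {v}) \<union> B\<close>. It is meaningful
    only if \<open>A - {v}\<close> and \<open>B\<close> are disjoint; by equivariance this determines the composition with
    values on the abstract disjoint union.
  \<^item> \<open>op_unit P v\<close> is the unit, in the space of the one-element set \<open>{v}\<close>.

  The records hold the data only, not the axioms.\<close>

record ('v, 'k, 'm) operad_data =
  op_space :: "'v set \<Rightarrow> 'm set"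
  op_scale :: "'k \<Rightarrow> 'm \<Rightarrow> 'm"
  op_act :: "'v set \<Rightarrow> ('v \<Rightarrow> 'v) \<Rightarrow> 'm \<Rightarrow> 'm"
  op_comp :: "'v set \<Rightarrow> 'v \<Rightarrow> 'v set \<Rightarrow> 'm \<Rightarrow> 'm \<Rightarrow> 'm"
  op_unit :: "'v \<Rightarrow> 'm"

text \<open>
  A commutative semigroup \<open>G\<close> is given as an additively closed subset of a commutative monoid, so
  that sums over finite nonempty sets are library sums. Maps from \<open>A\<close> to \<open>G\<close> are the elements of
  \<open>A \<rightarrow>\<^sub>E G\<close>. An element of the product of the \<open>P\<^sub>A\<^sub>,\<^sub>W\<close> is a family \<open>x\<close> with \<open>x W \<in> P\<^sub>A\<^sub>,\<^sub>W\<close> for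
  \<open>W \<in> A \<rightarrow>\<^sub>E G\<close>, extended by \<open>0\<close> to other functions \<open>W\<close>. The element with the single component
  \<open>\<alpha>\<close>, at \<open>W\<close>, is the one that is written \<open>(\<alpha>, W)\<close> in a product of copies.\<close>

record ('v, 'g, 'k, 'm) cp_operad_data = "('v, 'k, ('v \<Rightarrow> 'g) \<Rightarrow> 'm) operad_data" +
  cp_weights :: "'g set"
  cp_part :: "'v set \<Rightarrow> ('v \<Rightarrow> 'g) \<Rightarrow> 'm set"

definition product_space ::
  "'g set \<Rightarrow> ('v set \<Rightarrow> ('v \<Rightarrow> 'g) \<Rightarrow> 'm::zero set) \<Rightarrow> 'v set \<Rightarrow> (('v \<Rightarrow> 'g) \<Rightarrow> 'm) set" where
  "product_space G part A =
     {x. (\<forall>W\<in>A \<rightarrow>\<^sub>E G. x W \<in> part A W) \<and> (\<forall>W. W \<notin> A \<rightarrow>\<^sub>E G \<longrightarrow> x W = 0)}"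

text \<open>The weight function that is \<open>W\<close> on \<open>A - {v}\<close> and \<open>X\<close> on \<open>B\<close>.\<close>

definition join_weights ::
  "'v set \<Rightarrow> 'v \<Rightarrow> 'v set \<Rightarrow> ('v \<Rightarrow> 'g) \<Rightarrow> ('v \<Rightarrow> 'g) \<Rightarrow> ('v \<Rightarrow> 'g)" where
  "join_weights A v B W X = (\<lambda>a\<in>(A - {v}) \<union> B. if a \<in> B then X a else W a)"

text \<open>
  Extension to products of compositions \<open>h W X\<close> from \<open>P\<^sub>A\<^sub>,\<^sub>W \<times> P\<^sub>B\<^sub>,\<^sub>X\<close> to the part of weight
  \<open>join_weights A v B W X\<close>. For a given \<open>Z\<close>, the pairs \<open>(W, X)\<close> below differ only in the value
  \<open>W v\<close>, so that at most one summand is nonzero if \<open>h W X\<close> vanishes unless \<open>W v\<close> is the sum of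
  the \<open>X b\<close>, \<open>b \<in> B\<close>.\<close>

definition product_comp ::
  "'g set \<Rightarrow> 'v set \<Rightarrow> 'v \<Rightarrow> 'v set \<Rightarrow> (('v \<Rightarrow> 'g) \<Rightarrow> ('v \<Rightarrow> 'g) \<Rightarrow> 'm \<Rightarrow> 'm \<Rightarrow> 'm) \<Rightarrow>
   (('v \<Rightarrow> 'g) \<Rightarrow> 'm) \<Rightarrow> (('v \<Rightarrow> 'g) \<Rightarrow> 'm) \<Rightarrow> (('v \<Rightarrow> 'g) \<Rightarrow> 'm::comm_monoid_add)" where
  "product_comp G A v B h x y = (\<lambda>Z. Sum_any (\<lambda>(W, X).
     if W \<in> A \<rightarrow>\<^sub>E G \<and> X \<in> B \<rightarrow>\<^sub>E G \<and> join_weights A v B W X = Z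
     then h W X (x W) (y X) else 0))"

text \<open>Extension to products of maps \<open>h\<close>, each sending \<open>P\<^sub>A\<^sub>,\<^sub>W\<close> to the space of \<open>(A', W \<circ> \<sigma>)\<close>: the
  component at \<open>W'\<close> comes from the \<open>W\<close> on \<open>\<sigma>(A')\<close> with \<open>W \<circ> \<sigma> = W'\<close>.\<close>

definition product_act ::
  "'g set \<Rightarrow> 'v set \<Rightarrow> ('v \<Rightarrow> 'v) \<Rightarrow> ('m \<Rightarrow> 'm) \<Rightarrow>
   (('v \<Rightarrow> 'g) \<Rightarrow> 'm) \<Rightarrow> (('v \<Rightarrow> 'g) \<Rightarrow> 'm::zero)" where
  "product_act G A' \<sigma> h x = (\<lambda>W'. if W' \<in> A' \<rightarrow>\<^sub>E G
     then h (x (\<lambda>a\<in>\<sigma> ` A'. W' (inv_into A' \<sigma> a))) else 0)"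

text \<open>The current-preserving operad associated with an operad.\<close>

definition assoc_cp_operad ::
  "'g set \<Rightarrow> ('v, 'k, 'm) operad_data \<Rightarrow>
   ('v, 'g::comm_monoid_add, 'k, 'm::comm_monoid_add) cp_operad_data" where
  "assoc_cp_operad G P = \<lparr>
     op_space = product_space G (\<lambda>A W. op_space P A),
     op_scale = (\<lambda>c x W. op_scale P c (x W)),
     op_act = (\<lambda>A' \<sigma>. product_act G A' \<sigma> (op_act P A' \<sigma>)),
     op_comp = (\<lambda>A v B. product_comp G A v B
        (\<lambda>W X \<alpha> \<beta>. if (\<Sum>b\<in>B. X b) = W v then op_comp P A v B \<alpha> \<beta> else 0)),
     op_unit = (\<lambda>v W. if W \<in> {v} \<rightarrow>\<^sub>E G then op_unit P v else 0),
     cp_weights = G,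
     cp_part = (\<lambda>A W. op_space P A) \<rparr>"

text \<open>
  \<open>\<phi> A W\<close> maps \<open>P\<^sub>A\<^sub>,\<^sub>W\<close> to \<open>Q\<^sub>A\<^sub>,\<^sub>W\<close>. The family \<open>\<phi>\<close> is an isomorphism of current-preserving operads if
  these are bijections and the induced maps \<open>\<Phi> A\<close> of the products are linear and compatible with
  bijections, partial compositions and units.\<close>

definition product_map ::
  "'g set \<Rightarrow> ('v set \<Rightarrow> ('v \<Rightarrow> 'g) \<Rightarrow> 'm \<Rightarrow> 'n) \<Rightarrow> 'v set \<Rightarrow>
   (('v \<Rightarrow> 'g) \<Rightarrow> 'm) \<Rightarrow> (('v \<Rightarrow> 'g) \<Rightarrow> 'n::zero)" where
  "product_map G \<phi> A x = (\<lambda>W. if W \<in> A \<rightarrow>\<^sub>E G then \<phi> A W (x W) else 0)"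

definition cp_operad_iso ::
  "('v set \<Rightarrow> ('v \<Rightarrow> 'g) \<Rightarrow> 'm \<Rightarrow> 'n) \<Rightarrow>
   ('v, 'g, 'k, 'm::ab_group_add) cp_operad_data \<Rightarrow>
   ('v, 'g, 'k, 'n::ab_group_add) cp_operad_data \<Rightarrow> bool" where
  "cp_operad_iso \<phi> P Q \<longleftrightarrow>
     cp_weights P = cp_weights Q \<and>
     (let G = cp_weights P; \<Phi> = product_map G \<phi> in
       (\<forall>A. finite A \<and> A \<noteq> {} \<longrightarrow>
          (\<forall>W\<in>A \<rightarrow>\<^sub>E G. bij_betw (\<phi> A W) (cp_part P A W) (cp_part Q A W)) \<and>
          bij_betw (\<Phi> A) (op_space P A) (op_space Q A) \<and>
          (\<forall>x\<in>op_space P A. \<forall>y\<in>op_space P A. \<Phi> A (x + y) = \<Phi> A x + \<Phi> A y) \<and>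
          (\<forall>c. \<forall>x\<in>op_space P A. \<Phi> A (op_scale P c x) = op_scale Q c (\<Phi> A x))) \<and>
       (\<forall>A A' \<sigma>. finite A \<and> A \<noteq> {} \<and> bij_betw \<sigma> A' A \<longrightarrow>
          (\<forall>x\<in>op_space P A. \<Phi> A' (op_act P A' \<sigma> x) = op_act Q A' \<sigma> (\<Phi> A x))) \<and>
       (\<forall>A v B. finite A \<and> v \<in> A \<and> finite B \<and> B \<noteq> {} \<and> (A - {v}) \<inter> B = {} \<longrightarrow>
          (\<forall>x\<in>op_space P A. \<forall>y\<in>op_space P B.
             \<Phi> ((A - {v}) \<union> B) (op_comp P A v B x y) = op_comp Q A v B (\<Phi> A x) (\<Phi> B y))) \<and>
       (\<forall>v. \<Phi> {v} (op_unit P v) = op_unit Q v))"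


section \<open>Labelled planar rooted trees\<close>

text \<open>\<open>Node r [T\<^sub>1, \<dots>, T\<^sub>k]\<close> is \<open>B\<^sub>+(r, T\<^sub>1\<cdots>T\<^sub>k)\<close>. The labels of a tree in \<open>trees A\<close> are pairwise
  distinct, and its vertices are identified with their labels.\<close>

datatype (verts: 'v) ptree = Node (root: 'v) (branches: "'v ptree list")
  for map: relabel

primrec labels :: "'v ptree \<Rightarrow> 'v list" where
  "labels (Node r Ts) = r # concat (map labels Ts)"

definition trees :: "'v set \<Rightarrow> 'v ptree set" where
  "trees A = {T. distinct (labels T) \<and> set (labels T) = A}"

text \<open>The branches of the vertex \<open>v\<close>. The edges in \<open>E(S,v)\<close> are represented by their positions
  \<open>0, \<dots>, length (branches_at v S) - 1\<close>.\<close>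

primrec branches_at :: "'v \<Rightarrow> 'v ptree \<Rightarrow> 'v ptree list" where
  "branches_at v (Node r Ts) = (if r = v then Ts else concat (map (branches_at v) Ts))"

text \<open>All angles of \<open>T\<close>, in increasing order.\<close>

fun angles :: "'v ptree \<Rightarrow> ('v \<times> nat) list"
  and angles_after :: "'v \<Rightarrow> nat \<Rightarrow> 'v ptree list \<Rightarrow> ('v \<times> nat) list" where
  "angles (Node r Ts) = (r, 0) # angles_after r 1 Ts"
| "angles_after r i [] = []"
| "angles_after r i (T # Ts) = angles T @ (r, i) # angles_after r (Suc i) Ts"

definition Ang :: "'v ptree \<Rightarrow> ('v \<times> nat) set" where
  "Ang T = set (angles T)"

definition Ang0 :: "'v ptree \<Rightarrow> ('v \<times> nat) set" where
  "Ang0 T = {a \<in> Ang T. fst a = root T}"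

definition angle_le :: "'v ptree \<Rightarrow> 'v \<times> nat \<Rightarrow> 'v \<times> nat \<Rightarrow> bool" where
  "angle_le T a b \<longleftrightarrow> (\<exists>i j. i \<le> j \<and> j < length (angles T) \<and> angles T ! i = a \<and> angles T ! j = b)"

text \<open>The increasing maps from \<open>E(S,v)\<close> to a set \<open>Q\<close> of angles of \<open>T\<close>.\<close>

definition incr_maps ::
  "'v ptree \<Rightarrow> 'v \<Rightarrow> 'v ptree \<Rightarrow> ('v \<times> nat) set \<Rightarrow> (nat \<Rightarrow> 'v \<times> nat) set" where
  "incr_maps S v T Q = {f \<in> {..<length (branches_at v S)} \<rightarrow>\<^sub>E Q.
     \<forall>i j. i \<le> j \<and> j < length (branches_at v S) \<longrightarrow> angle_le T (f i) (f j)}"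

text \<open>\<open>graft g T\<close> plugs the list \<open>g a\<close> of trees into each angle \<open>a\<close> of \<open>T\<close>.\<close>

fun graft :: "('v \<times> nat \<Rightarrow> 'v ptree list) \<Rightarrow> 'v ptree \<Rightarrow> 'v ptree"
  and graft_after :: "('v \<times> nat \<Rightarrow> 'v ptree list) \<Rightarrow> 'v \<Rightarrow> nat \<Rightarrow> 'v ptree list \<Rightarrow> 'v ptree list" where
  "graft g (Node r Ts) = Node r (g (r, 0) @ graft_after g r 1 Ts)"
| "graft_after g r i [] = []"
| "graft_after g r i (T # Ts) = graft g T # g (r, i) @ graft_after g r (Suc i) Ts"

primrec replace_at :: "'v \<Rightarrow> ('v ptree list \<Rightarrow> 'v ptree) \<Rightarrow> 'v ptree \<Rightarrow> 'v ptree" where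
  "replace_at v F (Node r Ts) = (if r = v then F Ts else Node r (map (replace_at v F) Ts))"

text \<open>\<open>S \<diamond>\<^sub>v\<^sup>f T\<close>\<close>

definition subst_tree :: "'v ptree \<Rightarrow> 'v \<Rightarrow> (nat \<Rightarrow> 'v \<times> nat) \<Rightarrow> 'v ptree \<Rightarrow> 'v ptree" where
  "subst_tree S v f T =
     replace_at v (\<lambda>Bs. graft (\<lambda>a. map (\<lambda>j. Bs ! j) (filter (\<lambda>j. f j = a) [0..<length Bs])) T) S"


section \<open>The operads \<open>Brace\<close> and \<open>\<B>\<^sup>0\<close>\<close>

text \<open>\<open>Q T\<close> is the set of angles of \<open>T\<close> into which edges may be plugged.\<close>

definition tree_operad ::
  "('v ptree \<Rightarrow> ('v \<times> nat) set) \<Rightarrow> ('v, 'k::field, 'v ptree \<Rightarrow>\<^sub>0 'k) operad_data" where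
  "tree_operad Q = \<lparr>
     op_space = (\<lambda>A. span_of (trees A)),
     op_scale = scale,
     op_act = (\<lambda>A' \<sigma>. lin_ext (\<lambda>T. Poly_Mapping.single (relabel (inv_into A' \<sigma>) T) 1)),
     op_comp = (\<lambda>A v B. bilin_ext (\<lambda>S T.
        \<Sum>f\<in>incr_maps S v T (Q T). Poly_Mapping.single (subst_tree S v f T) 1)),
     op_unit = (\<lambda>v. Poly_Mapping.single (Node v []) 1) \<rparr>"

definition Brace :: "('v, 'k::field, 'v ptree \<Rightarrow>\<^sub>0 'k) operad_data" where
  "Brace = tree_operad Ang"

definition B_zero :: "('v, 'k::field, 'v ptree \<Rightarrow>\<^sub>0 'k) operad_data" where
  "B_zero = tree_operad Ang0"


section \<open>The current-preserving operad \<open>\<B>\<^sup>\<lambda>\<close>\<close>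

definition Npos :: "nat set" where
  "Npos = {n. 1 \<le> n}"

text \<open>A weighted tree is a pair \<open>(T, W)\<close> with \<open>W \<in> verts T \<rightarrow>\<^sub>E Npos\<close>.\<close>

type_synonym 'v wtree = "'v ptree \<times> ('v \<Rightarrow> nat)"

definition total_weight :: "'v wtree \<Rightarrow> nat" where
  "total_weight = (\<lambda>(T, W). \<Sum>u\<in>verts T. W u)"

text \<open>The number of edges from the vertex \<open>u\<close> to the root; as labels are distinct, at most one
  summand below is nonzero.\<close>

fun height :: "'v ptree \<Rightarrow> 'v \<Rightarrow> nat" where
  "height (Node r Ts) u = (if u = r then 0
     else sum_list (map (\<lambda>T. if u \<in> verts T then Suc (height T u) else 0) Ts))"

definition energy :: "'v wtree \<Rightarrow> nat" where
  "energy = (\<lambda>(T, W). \<Sum>u\<in>verts T. W u * height T u)"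

definition subst_wtree :: "'v wtree \<Rightarrow> 'v \<Rightarrow> (nat \<Rightarrow> 'v \<times> nat) \<Rightarrow> 'v wtree \<Rightarrow> 'v wtree" where
  "subst_wtree = (\<lambda>(S, W) v f (T, X).
     (subst_tree S v f T, join_weights (verts S) v (verts T) W X))"

text \<open>\<open>S \<diamond>\<^sub>v\<^sub>,\<^sub>\<lambda> T\<close>. The integer power has \<open>0 powi 0 = 1\<close>.\<close>

definition wcomp :: "'k::field \<Rightarrow> 'v \<Rightarrow> 'v wtree \<Rightarrow> 'v wtree \<Rightarrow> ('v wtree \<Rightarrow>\<^sub>0 'k)" where
  "wcomp lam v S T =
     (if total_weight T = snd S v then
        let f0 = (SOME f0. f0 \<in> incr_maps (fst S) v (fst T) (Ang0 (fst T))) in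
        \<Sum>f\<in>incr_maps (fst S) v (fst T) (Ang (fst T)).
          Poly_Mapping.single (subst_wtree S v f T)
            (lam powi (int (energy (subst_wtree S v f T)) - int (energy (subst_wtree S v f0 T))))
      else 0)"

definition wtree_part :: "'v set \<Rightarrow> ('v \<Rightarrow> nat) \<Rightarrow> ('v wtree \<Rightarrow>\<^sub>0 'k::field) set" where
  "wtree_part A W = span_of {(T, W) | T. T \<in> trees A}"

text \<open>The unit is the sum over \<open>n \<ge> 1\<close> of the one-vertex trees of weight \<open>n\<close>, i.e. the family whose
  component at each \<open>W\<close> on \<open>{v}\<close> is the one-vertex tree of weight \<open>W v\<close>.\<close>

definition B_lambda :: "'k \<Rightarrow> ('v, nat, 'k::field, 'v wtree \<Rightarrow>\<^sub>0 'k) cp_operad_data" where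
  "B_lambda lam = \<lparr>
     op_space = product_space Npos wtree_part,
     op_scale = (\<lambda>c x W. scale c (x W)),
     op_act = (\<lambda>A' \<sigma>. product_act Npos A' \<sigma> (lin_ext (\<lambda>(T, W).
        Poly_Mapping.single (relabel (inv_into A' \<sigma>) T, \<lambda>a\<in>A'. W (\<sigma> a)) 1))),
     op_comp = (\<lambda>A v B. product_comp Npos A v B (\<lambda>W X. bilin_ext (wcomp lam v))),
     op_unit = (\<lambda>v W. if W \<in> {v} \<rightarrow>\<^sub>E Npos then Poly_Mapping.single (Node v [], W) 1 else 0),
     cp_weights = Npos,
     cp_part = wtree_part \<rparr>"

text \<open>The identification of the weighted tree \<open>(T, W)\<close>, a basis vector of the part of weight \<open>W\<close> of
  \<open>\<B>\<^sup>\<lambda>\<close>, with the copy of \<open>T\<close> in the factor with index \<open>W\<close> of the associated current-preserving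
  operad.\<close>

definition identify_wtrees ::
  "'v set \<Rightarrow> ('v \<Rightarrow> nat) \<Rightarrow> ('v wtree \<Rightarrow>\<^sub>0 'k::field) \<Rightarrow> ('v ptree \<Rightarrow>\<^sub>0 'k)" where
  "identify_wtrees A W = lin_ext (\<lambda>t. Poly_Mapping.single (fst t) 1)"

end

(* Replacing v by T and plugging the j-th branch of v into an angle at the vertex u of T raises the
   energy, compared with plugging every branch at the root of T, by the sum over j of
   (height of u in T) * (weight of the j-th branch). As the weights are positive, this difference is 0
   exactly if all branches are plugged at the root. So 0 to the power of the difference selects the
   maps into the root angles, and 1 to that power keeps all maps. *)

theory Submission
  imports Defs "HOL-Library.Multiset"
begin

section \<open>Linear extensions\<close>

text \<open>The identification forgets the weights carried by a tree. The index \<open>W\<close> of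
  the component remembers them, so on each component it is a bijection of bases, and \<lambda>
  matters only in the composition of two basis trees. Two obstacles shape the rest. In a product,
  the pairs (W, X) that join to a given Z differ in the value W v, which ranges over infinitely many
  weights; only current conservation fixes this value and leaves one pair for each component. The
  energy is a sum over the vertex set with heights measured in the whole tree, whereas grafting and
  replacement recurse through lists of branches. It is therefore rewritten as a structural
  recursion. The rewriting is valid for distinct labels, so the labels of a substituted tree have to
  be shown distinct first.\<close>

lemma lookup_scale: "Poly_Mapping.lookup (scale c x) b = c * Poly_Mapping.lookup x b"
  unfolding scale_def by (simp add: Poly_Mapping.map.rep_eq when_def)

lemma scale_zero [simp]: "scale c 0 = 0"
  by (rule poly_mapping_eqI) (simp add: lookup_scale)

lemma zero_scale [simp]: "scale 0 x = 0"
  by (rule poly_mapping_eqI) (simp add: lookup_scale)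

lemma one_scale [simp]: "scale 1 x = x"
  by (rule poly_mapping_eqI) (simp add: lookup_scale)

lemma scale_scale: "scale c (scale d x) = scale (c * d) x"
  by (rule poly_mapping_eqI) (simp add: lookup_scale mult.assoc)

lemma add_scale: "scale (c + d) x = scale c x + scale d x"
  by (rule poly_mapping_eqI) (simp add: lookup_scale lookup_add distrib_right)

lemma scale_sum: "scale c (sum f I) = (\<Sum>i\<in>I. scale c (f i))"
  by (rule poly_mapping_eqI) (simp add: lookup_scale lookup_sum sum_distrib_left)

lemma scale_single: "scale c (Poly_Mapping.single b d) = Poly_Mapping.single b (c * d)"
  by (rule poly_mapping_eqI) (simp add: lookup_scale lookup_single when_def)

text \<open>Elements with different supports, such as \<open>x\<close>, \<open>y\<close> and
  \<open>x + y\<close>, can thus be expanded over one common index set.\<close>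

lemma lin_ext_superset:
  assumes "finite K" "Poly_Mapping.keys x \<subseteq> K"
  shows "lin_ext f x = (\<Sum>b\<in>K. scale (Poly_Mapping.lookup x b) (f b))"
  unfolding lin_ext_def using assms
  by (intro sum.mono_neutral_left) (auto simp: in_keys_iff)

lemma lin_ext_zero [simp]: "lin_ext f 0 = 0"
  by (simp add: lin_ext_def)

lemma lin_ext_add: "lin_ext f (x + y) = lin_ext f x + lin_ext f y"
proof -
  let ?K = "Poly_Mapping.keys x \<union> Poly_Mapping.keys y"
  have "Poly_Mapping.keys (x + y) \<subseteq> ?K"
    by (rule Poly_Mapping.keys_add)
  then show ?thesis
    by (simp add: lin_ext_superset[where K = ?K] lookup_add add_scale sum.distrib)
qed

lemma lin_ext_scale: "lin_ext f (scale c x) = scale c (lin_ext f x)"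
proof -
  have "Poly_Mapping.keys (scale c x) \<subseteq> Poly_Mapping.keys x"
    by (auto simp: in_keys_iff lookup_scale)
  then show ?thesis
    by (simp add: lin_ext_superset[where K = "Poly_Mapping.keys x"] lookup_scale scale_sum scale_scale)
qed

lemma lin_ext_sum: "lin_ext f (sum g I) = (\<Sum>i\<in>I. lin_ext f (g i))"
  by (induction I rule: infinite_finite_induct) (simp_all add: lin_ext_add)

lemma lin_ext_single [simp]: "lin_ext f (Poly_Mapping.single b c) = scale c (f b)"
  by (simp add: lin_ext_superset[where K = "{b}"])

lemma lin_ext_lin_ext: "lin_ext g (lin_ext f x) = lin_ext (\<lambda>b. lin_ext g (f b)) x"
  by (simp add: lin_ext_def[of f] lin_ext_sum lin_ext_scale lin_ext_def[of "\<lambda>b. lin_ext g (f b)"])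

lemma lin_ext_cong:
  "(\<And>b. b \<in> Poly_Mapping.keys x \<Longrightarrow> f b = g b) \<Longrightarrow> lin_ext f x = lin_ext g x"
  by (simp add: lin_ext_def)

lemma lin_ext_basis: "lin_ext (\<lambda>b. Poly_Mapping.single b 1) x = x"
  by (rule poly_mapping_eqI)
    (auto simp: lin_ext_def scale_single lookup_sum lookup_single when_def sum.delta in_keys_iff)

lemma lin_ext_basis_in_span:
  assumes "x \<in> span_of X" "h ` X \<subseteq> Y"
  shows "lin_ext (\<lambda>b. Poly_Mapping.single (h b) 1) x \<in> span_of Y"
proof -
  have "Poly_Mapping.keys (lin_ext (\<lambda>b. Poly_Mapping.single (h b) 1) x) \<subseteq> h ` Poly_Mapping.keys x"
    unfolding lin_ext_def scale_single
    by (rule order_trans[OF Poly_Mapping.keys_sum]) (auto split: if_splits)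
  also have "h ` Poly_Mapping.keys x \<subseteq> Y"
    using assms by (auto simp: span_of_def)
  finally show ?thesis by (simp add: span_of_def)
qed

text \<open>The inverse is the linear extension of \<open>inv_into X h\<close>: both composites fix
  the basis vectors that occur, hence are the identity on the spans.\<close>

lemma lin_ext_bij_betw:
  assumes "bij_betw h X Y"
  shows "bij_betw (lin_ext (\<lambda>b. Poly_Mapping.single (h b) (1::'k::field))) (span_of X) (span_of Y)"
proof (rule bij_betw_byWitness)
  let ?g = "inv_into X h"
  show "\<forall>x\<in>span_of X. lin_ext (\<lambda>b. Poly_Mapping.single (?g b) (1::'k))
      (lin_ext (\<lambda>b. Poly_Mapping.single (h b) 1) x) = x"
  proof
    fix x :: "_ \<Rightarrow>\<^sub>0 'k" assume x: "x \<in> span_of X"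
    have "lin_ext (\<lambda>b. Poly_Mapping.single (?g b) (1::'k)) (lin_ext (\<lambda>b. Poly_Mapping.single (h b) 1) x)
      = lin_ext (\<lambda>b. Poly_Mapping.single b 1) x"
      unfolding lin_ext_lin_ext
      by (rule lin_ext_cong) (use x assms in \<open>auto simp: span_of_def bij_betw_inv_into_left\<close>)
    then show "lin_ext (\<lambda>b. Poly_Mapping.single (?g b) (1::'k)) (lin_ext (\<lambda>b. Poly_Mapping.single (h b) 1) x) = x"
      by (simp add: lin_ext_basis)
  qed
  show "\<forall>x\<in>span_of Y. lin_ext (\<lambda>b. Poly_Mapping.single (h b) (1::'k))
      (lin_ext (\<lambda>b. Poly_Mapping.single (?g b) 1) x) = x"
  proof
    fix x :: "_ \<Rightarrow>\<^sub>0 'k" assume x: "x \<in> span_of Y"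
    have "lin_ext (\<lambda>b. Poly_Mapping.single (h b) (1::'k)) (lin_ext (\<lambda>b. Poly_Mapping.single (?g b) 1) x)
      = lin_ext (\<lambda>b. Poly_Mapping.single b 1) x"
      unfolding lin_ext_lin_ext
      by (rule lin_ext_cong) (use x assms in \<open>auto simp: span_of_def bij_betw_inv_into_right\<close>)
    then show "lin_ext (\<lambda>b. Poly_Mapping.single (h b) (1::'k)) (lin_ext (\<lambda>b. Poly_Mapping.single (?g b) 1) x) = x"
      by (simp add: lin_ext_basis)
  qed
  show "lin_ext (\<lambda>b. Poly_Mapping.single (h b) (1::'k)) ` span_of X \<subseteq> span_of Y"
    using assms by (auto simp: bij_betw_def intro!: lin_ext_basis_in_span)
  show "lin_ext (\<lambda>b. Poly_Mapping.single (?g b) (1::'k)) ` span_of Y \<subseteq> span_of X"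
    using bij_betw_inv_into[OF assms] by (auto simp: bij_betw_def intro!: lin_ext_basis_in_span)
qed

lemma bilin_ext_cong:
  assumes "\<And>a b. a \<in> Poly_Mapping.keys x \<Longrightarrow> b \<in> Poly_Mapping.keys y \<Longrightarrow> f a b = g a b"
  shows "bilin_ext f x y = bilin_ext g x y"
  unfolding bilin_ext_def using assms by (intro lin_ext_cong) auto

lemma bilin_ext_eq_0:
  assumes "\<And>a b. a \<in> Poly_Mapping.keys x \<Longrightarrow> b \<in> Poly_Mapping.keys y \<Longrightarrow> f a b = 0"
  shows "bilin_ext f x y = 0"
  using assms by (auto simp: bilin_ext_def lin_ext_def intro!: sum.neutral)

lemma lin_ext_bilin_ext:
  "lin_ext g (bilin_ext f x y) = bilin_ext (\<lambda>a b. lin_ext g (f a b)) x y"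
  by (simp add: bilin_ext_def lin_ext_lin_ext)

lemma bilin_ext_basis_maps:
  "bilin_ext f (lin_ext (\<lambda>b. Poly_Mapping.single (h b) 1) x) (lin_ext (\<lambda>b. Poly_Mapping.single (k b) 1) y)
    = bilin_ext (\<lambda>a b. f (h a) (k b)) x y"
  by (simp add: bilin_ext_def lin_ext_lin_ext)


section \<open>Products over weight functions\<close>

lemma product_map_bij_betw:
  assumes bij: "\<And>W. W \<in> A \<rightarrow>\<^sub>E G \<Longrightarrow> bij_betw (\<phi> A W) (p A W) (q A W)"
  shows "bij_betw (product_map G \<phi> A) (product_space G p A) (product_space G q A)"
proof (rule bij_betw_byWitness[where f' = "product_map G (\<lambda>A W. inv_into (p A W) (\<phi> A W)) A"])
  show "\<forall>x\<in>product_space G p A.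
      product_map G (\<lambda>A W. inv_into (p A W) (\<phi> A W)) A (product_map G \<phi> A x) = x"
    using bij_betw_imp_inj_on[OF bij]
    by (intro ballI ext) (simp add: product_space_def product_map_def)
  show "\<forall>x\<in>product_space G q A.
      product_map G \<phi> A (product_map G (\<lambda>A W. inv_into (p A W) (\<phi> A W)) A x) = x"
    using bij_betw_inv_into_right[OF bij]
    by (intro ballI ext) (simp add: product_space_def product_map_def)
  show "product_map G \<phi> A ` product_space G p A \<subseteq> product_space G q A"
    using bij_betwE[OF bij] by (simp add: product_space_def product_map_def image_subset_iff)
  show "product_map G (\<lambda>A W. inv_into (p A W) (\<phi> A W)) A ` product_space G q A \<subseteq> product_space G p A"
    using bij_betwE[OF bij_betw_inv_into[OF bij]]
    by (simp add: product_space_def product_map_def image_subset_iff)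
qed

lemma join_weights_in:
  assumes "W \<in> A \<rightarrow>\<^sub>E G" "X \<in> B \<rightarrow>\<^sub>E G"
  shows "join_weights A v B W X \<in> (A - {v}) \<union> B \<rightarrow>\<^sub>E G"
  using assms by (auto simp: join_weights_def PiE_iff)

lemma product_comp_outside:
  assumes "Z \<notin> (A - {v}) \<union> B \<rightarrow>\<^sub>E G"
  shows "product_comp G A v B h x y Z = 0"
proof -
  have "(\<lambda>(W, X). if W \<in> A \<rightarrow>\<^sub>E G \<and> X \<in> B \<rightarrow>\<^sub>E G \<and> join_weights A v B W X = Z
     then h W X (x W) (y X) else 0) = (\<lambda>_. 0)"
    using assms join_weights_in[of _ A G _ B v] by (intro ext) (auto split: prod.split)
  then show ?thesis by (simp add: product_comp_def)
qed

text \<open>\<open>Z\<close> determines \<open>X\<close> on \<open>B\<close> and \<open>W\<close> on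
  \<open>A - {v}\<close>, and leaves \<open>W v\<close> free. Since \<open>h\<close> vanishes on the
  given arguments unless \<open>W v\<close> is the sum of \<open>X\<close>, the only pair that can
  contribute is \<open>(W0, X0)\<close>; the sum has to lie in \<open>G\<close> for
  \<open>W0\<close> to be a weight function.\<close>

lemma product_comp_inside:
  fixes G :: "'g::comm_monoid_add set"
  assumes Z: "Z \<in> (A - {v}) \<union> B \<rightarrow>\<^sub>E G" and v: "v \<in> A" and AB: "(A - {v}) \<inter> B = {}"
    and G: "(\<Sum>b\<in>B. Z b) \<in> G"
    and h: "\<And>W X. W \<in> A \<rightarrow>\<^sub>E G \<Longrightarrow> X \<in> B \<rightarrow>\<^sub>E G \<Longrightarrow> (\<Sum>b\<in>B. X b) \<noteq> W v \<Longrightarrow> h W X (x W) (y X) = 0"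
  defines "W0 \<equiv> \<lambda>a\<in>A. if a = v then \<Sum>b\<in>B. Z b else Z a" and "X0 \<equiv> restrict Z B"
  shows "product_comp G A v B h x y Z = h W0 X0 (x W0) (y X0)"
    and "W0 \<in> A \<rightarrow>\<^sub>E G" and "X0 \<in> B \<rightarrow>\<^sub>E G" and "(\<Sum>b\<in>B. X0 b) = W0 v"
    and "join_weights A v B W0 X0 = Z"
proof -
  show W0: "W0 \<in> A \<rightarrow>\<^sub>E G" using Z G by (auto simp: W0_def PiE_iff)
  show X0: "X0 \<in> B \<rightarrow>\<^sub>E G" using Z by (auto simp: X0_def PiE_iff)
  show "(\<Sum>b\<in>B. X0 b) = W0 v" using v by (simp add: W0_def X0_def)
  show J: "join_weights A v B W0 X0 = Z"
    using Z by (auto simp: join_weights_def W0_def X0_def fun_eq_iff PiE_iff extensional_def)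
  let ?F = "\<lambda>p. case p of (W, X) \<Rightarrow> if W \<in> A \<rightarrow>\<^sub>E G \<and> X \<in> B \<rightarrow>\<^sub>E G \<and> join_weights A v B W X = Z
     then h W X (x W) (y X) else 0"
  have uniq: "W = W0 \<and> X = X0" if "?F (W, X) \<noteq> 0" for W X
  proof -
    from that have W: "W \<in> A \<rightarrow>\<^sub>E G" and X: "X \<in> B \<rightarrow>\<^sub>E G"
      and J: "join_weights A v B W X = Z" and "h W X (x W) (y X) \<noteq> 0"
      by (auto split: if_splits)
    then have s: "(\<Sum>b\<in>B. X b) = W v" using h by blast
    have XZ: "X b = Z b" if "b \<in> B" for b
      using that fun_cong[OF J, of b] by (simp add: join_weights_def)
    then have "X = X0" using X by (auto simp: X0_def fun_eq_iff PiE_iff extensional_def)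
    have "W a = W0 a" for a
    proof (cases "a \<in> A - {v}")
      case True
      then have "join_weights A v B W X a = W a" using AB by (auto simp: join_weights_def)
      then show ?thesis using True J by (auto simp: W0_def)
    next
      case False
      then show ?thesis using W s v XZ by (auto simp: W0_def PiE_iff extensional_def)
    qed
    with \<open>X = X0\<close> show ?thesis by auto
  qed
  \<comment> \<open>\<open>Sum_any\<close> ranges over all pairs of functions; \<open>uniq\<close>
    confines the support to one pair and so makes it finite.\<close>
  have "Sum_any ?F = sum ?F {(W0, X0)}"
    by (rule Sum_any.expand_superset) (use uniq in auto)
  then show "product_comp G A v B h x y Z = h W0 X0 (x W0) (y X0)"
    using W0 X0 J by (simp add: product_comp_def)
qed


section \<open>Labels and energy of a substitution\<close>

lemma verts_eq_labels: "verts T = set (labels T)"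
  by (induction T) auto

lemma verts_trees: "T \<in> trees A \<Longrightarrow> verts T = A"
  by (simp add: trees_def verts_eq_labels)

section \<open>Angles of a tree with distinct labels\<close>

lemma angles_vertices:
  "a \<in> set (angles T) \<Longrightarrow> fst a \<in> set (labels T)"
  "a \<in> set (angles_after r i Ts) \<Longrightarrow>
     (\<exists>T\<in>set Ts. fst a \<in> set (labels T)) \<or> (fst a = r \<and> i \<le> snd a)"
  by (induction T and r i Ts rule: angles_angles_after.induct) auto

text \<open>Angles in different branches differ in their vertex because the labels are distinct.
  Angles at \<open>r\<close> differ in their index, since those in
  \<open>angles_after r i Ts\<close> have index at least \<open>i\<close>.\<close>

lemma distinct_angles:
  fixes T :: "'v ptree" and r :: 'v and Ts :: "'v ptree list"
  shows "distinct (labels T) \<Longrightarrow> distinct (angles T)"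
    and "distinct (r # concat (map labels Ts)) \<Longrightarrow> distinct (angles_after r i Ts)"
proof (induction T and r i Ts rule: angles_angles_after.induct)
  case (1 r Ts)
  then show ?case using angles_vertices(2)[of "(r, 0)" r 1 Ts] by auto
next
  case (3 r i T Ts)
  have "(r, i) \<notin> set (angles_after r (Suc i) Ts)" "(r, i) \<notin> set (angles T)"
    using 3 angles_vertices(2)[of "(r, i)" r "Suc i" Ts] angles_vertices(1)[of _ T] by auto
  moreover have "set (angles T) \<inter> set (angles_after r (Suc i) Ts) = {}"
    using 3 angles_vertices(2)[of _ r "Suc i" Ts] angles_vertices(1)[of _ T] by fastforce
  ultimately show ?case using 3 by auto
qed simp

section \<open>Energy as a recursion over branches\<close>

abbreviation tree_weight :: "('v \<Rightarrow> nat) \<Rightarrow> 'v ptree \<Rightarrow> nat" where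
  "tree_weight Z T \<equiv> sum_list (map Z (labels T))"

text \<open>Each vertex of a branch lies one edge deeper in the tree than in the branch alone, which
  adds the weight of the branch to its energy.\<close>

primrec tree_energy :: "('v \<Rightarrow> nat) \<Rightarrow> 'v ptree \<Rightarrow> nat" where
  "tree_energy Z (Node r Ts) =
     sum_list (map (tree_weight Z) Ts) + sum_list (map (tree_energy Z) Ts)"

text \<open>\<open>height\<close> sums over all branches; distinct labels leave only the summand of
  the branch that contains \<open>u\<close>.\<close>

lemma height_branch:
  assumes d: "distinct (labels (Node r Ts))" and T: "T \<in> set Ts" and u: "u \<in> set (labels T)"
  shows "height (Node r Ts) u = Suc (height T u)"
proof -
  obtain xs ys where Ts: "Ts = xs @ T # ys" using split_list[OF T] by blast
  have ur: "u \<noteq> r" using d T u by auto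
  have fresh: "u \<notin> set (labels U)" if "U \<in> set xs \<union> set ys" for U
    using that d u unfolding Ts by auto
  have "map (\<lambda>T. if u \<in> verts T then Suc (height T u) else 0) xs = map (\<lambda>_. 0) xs"
    by (rule map_cong[OF refl]) (simp add: verts_eq_labels fresh)
  moreover have "map (\<lambda>T. if u \<in> verts T then Suc (height T u) else 0) ys = map (\<lambda>_. 0) ys"
    by (rule map_cong[OF refl]) (simp add: verts_eq_labels fresh)
  ultimately show ?thesis using u ur by (simp add: Ts verts_eq_labels)
qed

lemma height_eq_0_iff:
  assumes "u \<in> set (labels T)"
  shows "height T u = 0 \<longleftrightarrow> u = root T"
  using assms by (cases T) (auto simp: verts_eq_labels)

lemma energy_eq_tree_energy:
  assumes "distinct (labels T)"
  shows "energy (T, Z) = tree_energy Z T"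
proof -
  have "sum_list (map (\<lambda>u. Z u * height T u) (labels T)) = tree_energy Z T"
    using assms
  proof (induction T)
    case (Node r Ts)
    \<comment> \<open>The induction runs over a list \<open>Us\<close> of branches, while heights
      stay those in the full tree \<open>Node r Ts\<close>, so that \<open>height_branch\<close>
      applies at every stage. The claim is the instance \<open>Us = Ts\<close>.\<close>
    have "sum_list (map (\<lambda>u. Z u * height (Node r Ts) u) (concat (map labels Us)))
        = sum_list (map (\<lambda>T. sum_list (map Z (labels T))) Us) + sum_list (map (tree_energy Z) Us)"
      if "set Us \<subseteq> set Ts" for Us
      using that
    proof (induction Us)
      case (Cons U Us)
      then have U: "U \<in> set Ts" by simp
      have "distinct (labels U)"
        using U Node.prems by (simp add: distinct_concat_iff)
      then have "sum_list (map (\<lambda>u. Z u * height U u) (labels U)) = tree_energy Z U"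
        using Node.IH U by blast
      moreover have "map (\<lambda>u. Z u * height (Node r Ts) u) (labels U)
          = map (\<lambda>u. Z u + Z u * height U u) (labels U)"
        using height_branch[OF Node.prems U] by simp
      ultimately have "sum_list (map (\<lambda>u. Z u * height (Node r Ts) u) (labels U))
          = sum_list (map Z (labels U)) + tree_energy Z U"
        by (simp only: sum_list_addf)
      then show ?case using Cons by (simp del: height.simps)
    qed simp
    moreover have "height (Node r Ts) r = 0" by simp
    ultimately show ?case by (simp del: height.simps)
  qed
  with assms show ?thesis
    by (simp add: energy_def verts_eq_labels sum_list_distinct_conv_sum_set)
qed

section \<open>Labels, weight and energy of a grafted tree\<close>

lemma mset_labels_graft:
  "mset (labels (graft g T)) =
     mset (labels T) + mset (concat (map (\<lambda>a. concat (map labels (g a))) (angles T)))"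
  "mset (concat (map labels (graft_after g r i Ts))) =
     mset (concat (map labels Ts)) + mset (concat (map (\<lambda>a. concat (map labels (g a))) (angles_after r i Ts)))"
  by (induction T and r i Ts rule: angles_angles_after.induct) (simp_all add: ac_simps)

lemma sum_list_map_concat:
  "sum_list (map f (concat xss)) = sum_list (map (\<lambda>xs. sum_list (map f xs)) xss)"
  by (induction xss) auto

lemma tree_weight_graft:
  "tree_weight Z (graft g T) =
     tree_weight Z T + sum_list (map (\<lambda>a. sum_list (map (tree_weight Z) (g a))) (angles T))"
  "sum_list (map (tree_weight Z) (graft_after g r i Ts)) =
     sum_list (map (tree_weight Z) Ts)
     + sum_list (map (\<lambda>a. sum_list (map (tree_weight Z) (g a))) (angles_after r i Ts))"
  by (induction T and r i Ts rule: angles_angles_after.induct)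
    (simp_all add: sum_list_map_concat comp_def)

lemma height_Cons:
  assumes "distinct (labels (Node r (T # Ts)))"
  shows "u \<in> set (labels T) \<Longrightarrow> height (Node r (T # Ts)) u = Suc (height T u)"
    and "u \<notin> set (labels T) \<Longrightarrow> height (Node r (T # Ts)) u = height (Node r Ts) u"
  using height_branch[OF assms] by (auto simp: verts_eq_labels)

text \<open>A tree plugged into an angle at \<open>u\<close> is lifted by \<open>height T u + 1\<close>.\<close>

lemma tree_energy_graft:
  "distinct (labels T) \<Longrightarrow> tree_energy Z (graft g T) = tree_energy Z T +
     sum_list (map (\<lambda>a. sum_list (map (\<lambda>U. tree_weight Z U + tree_energy Z U) (g a))
       + height T (fst a) * sum_list (map (tree_weight Z) (g a))) (angles T))"
  "distinct (labels (Node r Ts)) \<Longrightarrow>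
     sum_list (map (\<lambda>U. tree_weight Z U + tree_energy Z U) (graft_after g r i Ts)) =
     sum_list (map (\<lambda>U. tree_weight Z U + tree_energy Z U) Ts) +
     sum_list (map (\<lambda>a. sum_list (map (\<lambda>U. tree_weight Z U + tree_energy Z U) (g a))
       + height (Node r Ts) (fst a) * sum_list (map (tree_weight Z) (g a))) (angles_after r i Ts))"
proof (induction T and r i Ts rule: angles_angles_after.induct)
  case (1 r Ts)
  then show ?case by (simp add: sum_list_addf del: height.simps) simp
next
  case (3 r i T Ts)
  have dT: "distinct (labels T)" and dTs: "distinct (labels (Node r Ts))"
    using "3.prems" by auto
  let ?w = "\<lambda>a. sum_list (map (tree_weight Z) (g a))"
  \<comment> \<open>An angle of the branch \<open>T\<close> sits one edge deeper in the whole tree.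
    The additional \<open>?w a\<close> is what plugging into \<open>a\<close> adds to the weight of
    the branch, and the second statement counts weight plus energy of each branch.\<close>
  have "sum_list (map (\<lambda>a. height (Node r (T # Ts)) (fst a) * ?w a) (angles T))
      = sum_list (map (\<lambda>a. ?w a + height T (fst a) * ?w a) (angles T))"
    using angles_vertices(1)[of _ T] height_Cons(1)[OF "3.prems"]
    by (intro arg_cong[of _ _ sum_list] map_cong refl) simp
  moreover have "sum_list (map (\<lambda>a. height (Node r (T # Ts)) (fst a) * ?w a) (angles_after r (Suc i) Ts))
      = sum_list (map (\<lambda>a. height (Node r Ts) (fst a) * ?w a) (angles_after r (Suc i) Ts))"
  proof (intro arg_cong[of _ _ sum_list] map_cong refl)
    fix a assume "a \<in> set (angles_after r (Suc i) Ts)"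
    then have "fst a \<notin> set (labels T)"
      using angles_vertices(2)[of a r "Suc i" Ts] "3.prems" by auto
    then show "height (Node r (T # Ts)) (fst a) * ?w a = height (Node r Ts) (fst a) * ?w a"
      using height_Cons(2)[OF "3.prems"] by simp
  qed
  moreover have "height (Node r (T # Ts)) r = 0" by simp
  ultimately show ?case
    using "3.IH"(1)[OF dT] "3.IH"(2)[OF dTs]
    by (simp add: sum_list_addf tree_weight_graft(1) del: height.simps)
qed simp

section \<open>Replacement of one vertex of a tree\<close>

lemma replace_at_fresh: "v \<notin> set (labels S) \<Longrightarrow> replace_at v F S = S"
  by (induction S) (auto intro: map_idI)

lemma branches_at_fresh: "v \<notin> set (labels S) \<Longrightarrow> branches_at v S = []"
  by (induction S) auto

text \<open>Labels being distinct, a vertex \<open>v\<close> other than the root lies in exactly one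
  branch, and both \<open>replace_at\<close> and \<open>branches_at\<close> act inside that branch
  alone. This case split drives the inductions on \<open>S\<close>.\<close>

lemma replace_at_cases [consumes 2, case_names root branch]:
  assumes "distinct (labels (Node r Ts))" "v \<in> set (labels (Node r Ts))"
  obtains "v = r"
  | xs T ys where "v \<noteq> r" "Ts = xs @ T # ys" "T \<in> set Ts" "distinct (labels T)" "v \<in> set (labels T)"
      "\<And>F. replace_at v F (Node r Ts) = Node r (xs @ replace_at v F T # ys)"
      "branches_at v (Node r Ts) = branches_at v T"
proof (cases "v = r")
  case False
  then obtain T where T: "T \<in> set Ts" "v \<in> set (labels T)" using assms(2) by auto
  then obtain xs ys where Ts: "Ts = xs @ T # ys" using split_list[OF T(1)] by blast
  have fresh: "\<And>U. U \<in> set xs \<union> set ys \<Longrightarrow> v \<notin> set (labels U)"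
    using assms(1) T(2) unfolding Ts by auto
  have "map (replace_at v F) xs = xs" "map (replace_at v F) ys = ys" for F
    using fresh by (auto intro!: map_idI replace_at_fresh)
  moreover have "concat (map (branches_at v) xs) = []" "concat (map (branches_at v) ys) = []"
    using fresh by (auto simp: branches_at_fresh)
  then have "concat (map (branches_at v) Ts) = branches_at v T"
    by (simp only: Ts map_append list.map concat_append concat.simps append_Nil append_Nil2)
  ultimately show ?thesis using False T assms(1) by (intro that(2)[of xs T ys]) (auto simp: Ts)
qed (use that in blast)

text \<open>What is removed stands on the left as an added term, which avoids subtraction of
  multisets.\<close>

lemma mset_labels_replace_at:
  assumes "distinct (labels S)" "v \<in> set (labels S)"
  shows "mset (labels (replace_at v F S)) + mset (v # concat (map labels (branches_at v S)))
    = mset (labels S) + mset (labels (F (branches_at v S)))"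
  using assms
proof (induction S)
  case (Node r Ts)
  from Node.prems show ?case
  proof (cases rule: replace_at_cases)
    case root
    then show ?thesis by simp
  next
    case (branch xs T ys)
    show ?thesis
      using Node.IH[OF branch(3,4,5)] unfolding branch(6,7)
      by (simp add: branch(2) ac_simps)
  qed
qed

text \<open>The energy of a node involves the weights of its branches, so a change of weight would
  contribute once for every edge between \<open>v\<close> and the root. Equality of the weights is
  therefore part of the induction, and then the energy difference \<open>d\<close> passes to
  \<open>S\<close> unchanged.\<close>

lemma tree_energy_replace_at:
  assumes "distinct (labels S)" "v \<in> set (labels S)"
    and "tree_weight Z (F (branches_at v S)) = tree_weight Z (F' (branches_at v S))"
    and "tree_energy Z (F (branches_at v S)) = tree_energy Z (F' (branches_at v S)) + d"
  shows "tree_weight Z (replace_at v F S) = tree_weight Z (replace_at v F' S) \<and>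
    tree_energy Z (replace_at v F S) = tree_energy Z (replace_at v F' S) + d"
  using assms
proof (induction S)
  case (Node r Ts)
  from Node.prems(1,2) show ?case
  proof (cases rule: replace_at_cases)
    case root
    then show ?thesis using Node.prems(3,4) by simp
  next
    case (branch xs T ys)
    show ?thesis
      using Node.IH[OF branch(3,4,5)] Node.prems(3,4) unfolding branch(6,7)
      by simp
  qed
qed

lemma branches_at_labels:
  "U \<in> set (branches_at v S) \<Longrightarrow> set (labels U) \<subseteq> set (labels S)"
  "distinct (labels S) \<Longrightarrow> U \<in> set (branches_at v S) \<Longrightarrow> v \<notin> set (labels U)"
  by (induction S) (fastforce split: if_splits simp: distinct_concat_iff)+

section \<open>Sums over the branches plugged into angles\<close>

definition plugged :: "'v ptree list \<Rightarrow> (nat \<Rightarrow> 'v \<times> nat) \<Rightarrow> 'v \<times> nat \<Rightarrow> 'v ptree list" where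
  "plugged Bs f a = map (\<lambda>j. Bs ! j) (filter (\<lambda>j. f j = a) [0..<length Bs])"

text \<open>Each branch goes into exactly one angle, so the sum over angles regroups into a sum over
  branches. The value type is general because this is applied to multisets of labels as well as to
  weights and energies.\<close>

lemma sum_plugged:
  fixes F :: "'v \<times> nat \<Rightarrow> 'v ptree \<Rightarrow> 'b::comm_monoid_add"
  assumes "distinct as" "f ` {..<length Bs} \<subseteq> set as"
  shows "sum_list (map (\<lambda>a. sum_list (map (F a) (plugged Bs f a))) as)
    = (\<Sum>j<length Bs. F (f j) (Bs ! j))"
proof -
  \<comment> \<open>On the fibre of \<open>f\<close> over \<open>a\<close>, writing
    \<open>F (f j)\<close> for \<open>F a\<close> makes the summand independent of \<open>a\<close>,
    so the fibres can be put together.\<close>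
  have "sum_list (map (F a) (plugged Bs f a)) = (\<Sum>j\<in>{j\<in>{..<length Bs}. f j = a}. F (f j) (Bs ! j))" for a
  proof -
    have "sum_list (map (F a) (plugged Bs f a))
        = sum_list (map (\<lambda>j. F a (Bs ! j)) (filter (\<lambda>j. f j = a) [0..<length Bs]))"
      by (simp add: plugged_def comp_def)
    also have "\<dots> = (\<Sum>j\<in>{j\<in>{..<length Bs}. f j = a}. F a (Bs ! j))"
      by (subst sum_list_distinct_conv_sum_set) (auto intro!: sum.cong)
    finally show ?thesis by simp
  qed
  then have "sum_list (map (\<lambda>a. sum_list (map (F a) (plugged Bs f a))) as)
      = (\<Sum>a\<in>set as. \<Sum>j\<in>{j\<in>{..<length Bs}. f j = a}. F (f j) (Bs ! j))"
    using assms(1) by (simp add: sum_list_distinct_conv_sum_set)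
  also have "\<dots> = (\<Sum>j<length Bs. F (f j) (Bs ! j))"
    using assms(2) by (intro sum.group) auto
  finally show ?thesis .
qed

lemma subst_tree_plugged: "subst_tree S v f T = replace_at v (\<lambda>Bs. graft (plugged Bs f) T) S"
  by (simp add: subst_tree_def plugged_def[abs_def])

section \<open>Labels and energy of a substituted tree\<close>

context
  fixes S T :: "'v ptree" and v :: 'v and A B :: "'v set"
  assumes S: "S \<in> trees A" and T: "T \<in> trees B" and v: "v \<in> A" and AB: "(A - {v}) \<inter> B = {}"
begin

text \<open>The branches of \<open>v\<close> leave \<open>S\<close> and return inside the grafted
  \<open>T\<close>, so the labels lose one \<open>v\<close> and gain those of \<open>T\<close>.
  Counting with multisets disregards the order in which they end up.\<close>

lemma distinct_subst_tree:
  assumes f: "f ` {..<length (branches_at v S)} \<subseteq> Ang T"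
  shows "distinct (labels (subst_tree S v f T))"
proof -
  let ?Bs = "branches_at v S"
  have dT: "distinct (labels T)" and dS: "distinct (labels S)" and vS: "v \<in> set (labels S)"
    using S T v by (auto simp: trees_def)
  have "mset (concat (map (\<lambda>a. concat (map labels (plugged ?Bs f a))) (angles T)))
      = sum_list (map (\<lambda>a. sum_list (map (\<lambda>U. mset (labels U)) (plugged ?Bs f a))) (angles T))"
    by (simp add: mset_concat comp_def)
  also have "\<dots> = (\<Sum>j<length ?Bs. mset (labels (?Bs ! j)))"
    using f distinct_angles(1)[OF dT] by (intro sum_plugged) (simp_all add: Ang_def)
  also have "\<dots> = mset (concat (map labels ?Bs))"
    by (simp add: mset_concat comp_def sum_list_sum_nth atLeast0LessThan)
  finally have "mset (labels (graft (plugged ?Bs f) T)) = mset (labels T) + mset (concat (map labels ?Bs))"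
    by (simp add: mset_labels_graft(1))
  with mset_labels_replace_at[OF dS vS, of "\<lambda>Bs. graft (plugged Bs f) T"]
  have "mset (labels (subst_tree S v f T)) + {#v#} = mset (labels S) + mset (labels T)"
    unfolding subst_tree_plugged by (simp add: ac_simps)
  \<comment> \<open>\<open>B\<close> may contain \<open>v\<close>, so the one \<open>v\<close> is
    removed from the labels of \<open>S\<close> and not from those of the result.\<close>
  then have "mset (labels (subst_tree S v f T)) = mset (remove1 v (labels S) @ labels T)"
    using vS by (auto dest!: multi_member_split simp flip: set_mset_mset)
  moreover have "distinct (remove1 v (labels S) @ labels T)"
    using dS dT S T AB by (auto simp: trees_def)
  ultimately show ?thesis by (metis mset_eq_imp_distinct_iff)
qed

lemma energy_subst_tree:
  assumes f: "f ` {..<length (branches_at v S)} \<subseteq> Ang T"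
    and f0: "f0 ` {..<length (branches_at v S)} \<subseteq> Ang0 T"
  shows "energy (subst_tree S v f T, Z) = energy (subst_tree S v f0 T, Z)
    + (\<Sum>j<length (branches_at v S). height T (fst (f j)) * tree_weight Z (branches_at v S ! j))"
proof -
  let ?Bs = "branches_at v S"
  have dT: "distinct (labels T)" and dS: "distinct (labels S)" and vS: "v \<in> set (labels S)"
    using S T v by (auto simp: trees_def)
  have f0': "f0 ` {..<length ?Bs} \<subseteq> Ang T" using f0 by (auto simp: Ang0_def)
  have da: "distinct (angles T)" by (rule distinct_angles(1)[OF dT])
  \<comment> \<open>Only the last sum in \<open>E\<close> depends on \<open>g\<close>, and the
    weight \<open>W\<close> does not depend on it at all; the latter is the condition under which
    \<open>tree_energy_replace_at\<close> carries the difference over to \<open>S\<close>.\<close>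
  have E: "tree_energy Z (graft (plugged ?Bs g) T) = tree_energy Z T +
      (\<Sum>j<length ?Bs. tree_weight Z (?Bs ! j) + tree_energy Z (?Bs ! j))
      + (\<Sum>j<length ?Bs. height T (fst (g j)) * tree_weight Z (?Bs ! j))"
    and W: "tree_weight Z (graft (plugged ?Bs g) T) = tree_weight Z T + (\<Sum>j<length ?Bs. tree_weight Z (?Bs ! j))"
    if g: "g ` {..<length ?Bs} \<subseteq> Ang T" for g
  proof -
    note sp = sum_plugged[OF da g[unfolded Ang_def]]
    show "tree_weight Z (graft (plugged ?Bs g) T) = tree_weight Z T + (\<Sum>j<length ?Bs. tree_weight Z (?Bs ! j))"
      using sp[of "\<lambda>_. tree_weight Z"] by (simp add: tree_weight_graft(1))
    show "tree_energy Z (graft (plugged ?Bs g) T) = tree_energy Z T +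
      (\<Sum>j<length ?Bs. tree_weight Z (?Bs ! j) + tree_energy Z (?Bs ! j))
      + (\<Sum>j<length ?Bs. height T (fst (g j)) * tree_weight Z (?Bs ! j))"
      using sp[of "\<lambda>_ U. tree_weight Z U + tree_energy Z U"]
        sp[of "\<lambda>a U. height T (fst a) * tree_weight Z U"]
      by (simp only: tree_energy_graft(1)[OF dT] sum_list_addf sum_list_const_mult add.assoc)
  qed
  have root: "height T (fst (f0 j)) = 0" if "j < length ?Bs" for j
  proof -
    have "f0 j \<in> Ang0 T" using f0 that by auto
    then show ?thesis by (cases T) (auto simp: Ang0_def)
  qed
  then have 0: "(\<Sum>j<length ?Bs. height T (fst (f0 j)) * tree_weight Z (?Bs ! j)) = 0" by simp
  have "tree_energy Z (subst_tree S v f T) = tree_energy Z (subst_tree S v f0 T)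
      + (\<Sum>j<length ?Bs. height T (fst (f j)) * tree_weight Z (?Bs ! j))"
    unfolding subst_tree_plugged
    by (rule tree_energy_replace_at[OF dS vS, THEN conjunct2])
      (simp_all only: E[OF f] E[OF f0'] W[OF f] W[OF f0'] 0 add_0_right)
  then show ?thesis
    by (simp add: energy_eq_tree_energy distinct_subst_tree f f0')
qed

lemma energy_subst_tree_eq_iff:
  assumes f: "f ` {..<length (branches_at v S)} \<subseteq> Ang T"
    and f0: "f0 ` {..<length (branches_at v S)} \<subseteq> Ang0 T"
    and Z: "\<And>u. u \<in> A - {v} \<Longrightarrow> 0 < Z u"
  shows "energy (subst_tree S v f T, Z) = energy (subst_tree S v f0 T, Z)
    \<longleftrightarrow> f ` {..<length (branches_at v S)} \<subseteq> Ang0 T"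
proof -
  let ?Bs = "branches_at v S"
  \<comment> \<open>The root of the branch is a vertex of \<open>S\<close> other than
    \<open>v\<close>, and its positive weight is one summand of the weight of the branch.\<close>
  have pos: "tree_weight Z (?Bs ! j) \<noteq> 0" if "j < length ?Bs" for j
  proof -
    let ?U = "?Bs ! j"
    have U: "?U \<in> set ?Bs" using that by simp
    have "root ?U \<in> set (labels ?U)" by (cases ?U) auto
    moreover from this have "root ?U \<in> A - {v}"
      using branches_at_labels(1)[OF U] branches_at_labels(2)[OF _ U] S by (auto simp: trees_def)
    ultimately show ?thesis using Z by force
  qed
  have "height T (fst (f j)) = 0 \<longleftrightarrow> f j \<in> Ang0 T" if "j < length ?Bs" for j
  proof -
    have a: "f j \<in> Ang T" using f that by auto
    then have "fst (f j) \<in> set (labels T)" using angles_vertices(1)[of _ T] by (auto simp: Ang_def)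
    then show ?thesis using a by (simp add: height_eq_0_iff Ang0_def)
  qed
  then have "height T (fst (f j)) * tree_weight Z (?Bs ! j) = 0 \<longleftrightarrow> f j \<in> Ang0 T"
    if "j < length ?Bs" for j
    using that pos[OF that] by (simp only: mult_is_0 simp_thms)
  then have "(\<Sum>j<length ?Bs. height T (fst (f j)) * tree_weight Z (?Bs ! j)) = 0
      \<longleftrightarrow> f ` {..<length ?Bs} \<subseteq> Ang0 T"
    by (simp only: sum_eq_0_iff finite_lessThan image_subset_iff lessThan_iff Ball_def simp_thms) blast
  then show ?thesis
    by (simp only: energy_subst_tree[OF f f0] add_cancel_left_right)
qed

end

section \<open>Increasing maps into angles\<close>

lemma finite_incr_maps: "finite Q \<Longrightarrow> finite (incr_maps S v T Q)"
  unfolding incr_maps_def by (rule finite_subset[of _ "{..<length (branches_at v S)} \<rightarrow>\<^sub>E Q"])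
    (auto intro: finite_PiE)

lemma incr_maps_image: "f \<in> incr_maps S v T Q \<Longrightarrow> f ` {..<length (branches_at v S)} \<subseteq> Q"
  by (auto simp: incr_maps_def PiE_iff)

text \<open>In both cases monotonicity refers to the order of all angles of \<open>T\<close>, so
  only the target is restricted.\<close>

lemma incr_maps_Ang0:
  "incr_maps S v T (Ang0 T) =
     {f \<in> incr_maps S v T (Ang T). f ` {..<length (branches_at v S)} \<subseteq> Ang0 T}"
  by (auto simp: incr_maps_def PiE_iff Ang0_def)

text \<open>This gives content to the choice of \<open>f0\<close> in \<open>wcomp\<close>. The
  witness plugs every branch into the leftmost root angle, the first entry of
  \<open>angles T\<close>.\<close>

lemma incr_maps_Ang0_nonempty: "incr_maps S v T (Ang0 T) \<noteq> {}"
proof -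
  obtain r Ts where T: "T = Node r Ts" by (cases T)
  have "(\<lambda>j\<in>{..<length (branches_at v S)}. (r, 0)) \<in> incr_maps S v T (Ang0 T)"
    by (auto simp: incr_maps_def Ang0_def Ang_def T angle_le_def intro!: exI[of _ 0])
  then show ?thesis by blast
qed


section \<open>The isomorphisms\<close>

text \<open>An empty sum would be 0, which is not a weight. The lemma supplies the weight that
  current conservation prescribes at \<open>v\<close>.\<close>

lemma sum_Npos:
  assumes "finite B" "B \<noteq> {}" "X \<in> B \<rightarrow> Npos"
  shows "(\<Sum>b\<in>B. X b) \<in> Npos"
proof -
  obtain b where b: "b \<in> B" using assms(2) by blast
  have "1 \<le> X b" using assms(3) b by (auto simp: Npos_def)
  also have "X b \<le> (\<Sum>b\<in>B. X b)" using assms(1) b by (intro member_le_sum) auto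
  finally show ?thesis by (simp add: Npos_def)
qed

section \<open>Compositions of basis trees for \<lambda> = 0 and \<lambda> = 1\<close>

lemma lin_ext_fst_wcomp_zero:
  assumes S: "S \<in> trees A" and T: "T \<in> trees B" and v: "v \<in> A" and AB: "(A - {v}) \<inter> B = {}"
    and W: "W \<in> A \<rightarrow>\<^sub>E Npos" and X: "X \<in> B \<rightarrow>\<^sub>E Npos"
  shows "lin_ext (\<lambda>t. Poly_Mapping.single (fst t) 1) (wcomp (0::'k::field) v (S, W) (T, X)) =
    (if (\<Sum>b\<in>B. X b) = W v
     then \<Sum>f\<in>incr_maps S v T (Ang0 T). Poly_Mapping.single (subst_tree S v f T) 1 else 0)"
proof (cases "(\<Sum>b\<in>B. X b) = W v")
  case True
  define f0 where "f0 = (SOME f0. f0 \<in> incr_maps S v T (Ang0 T))"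
  have "f0 \<in> incr_maps S v T (Ang0 T)"
    unfolding f0_def using incr_maps_Ang0_nonempty[of S v T] by (simp add: some_in_eq)
  then have f0: "f0 ` {..<length (branches_at v S)} \<subseteq> Ang0 T" by (rule incr_maps_image)
  define Z where "Z = join_weights A v B W X"
  \<comment> \<open>On \<open>A - {v}\<close>, which is disjoint from \<open>B\<close>, the joined
    weights are those of \<open>W\<close>.\<close>
  have Z: "0 < Z u" if "u \<in> A - {v}" for u
    using that AB W by (auto simp: Z_def join_weights_def Npos_def PiE_iff dest!: bspec)
  define c :: "_ \<Rightarrow> 'k" where
    "c f = 0 powi (int (energy (subst_tree S v f T, Z)) - int (energy (subst_tree S v f0 T, Z)))" for f
  have c: "c f = (if f \<in> incr_maps S v T (Ang0 T) then 1 else 0)" if "f \<in> incr_maps S v T (Ang T)" for f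
  proof -
    \<comment> \<open>\<open>0 powi m\<close> is 0 for negative \<open>m\<close> too, so the
      coefficient depends only on whether the two energies agree.\<close>
    have "c f = (if energy (subst_tree S v f T, Z) = energy (subst_tree S v f0 T, Z) then 1 else 0)"
      by (simp add: c_def power_int_0_left_if)
    moreover have "energy (subst_tree S v f T, Z) = energy (subst_tree S v f0 T, Z)
        \<longleftrightarrow> f ` {..<length (branches_at v S)} \<subseteq> Ang0 T"
      by (rule energy_subst_tree_eq_iff[OF S T v AB incr_maps_image[OF that] f0]) (fact Z)
    ultimately show ?thesis
      using that by (simp add: incr_maps_Ang0)
  qed
  have "lin_ext (\<lambda>t. Poly_Mapping.single (fst t) 1) (wcomp 0 v (S, W) (T, X))
      = (\<Sum>f\<in>incr_maps S v T (Ang T). Poly_Mapping.single (subst_tree S v f T) (c f))"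
    using True S T
    by (simp add: wcomp_def total_weight_def verts_trees subst_wtree_def lin_ext_sum scale_single
        c_def f0_def Z_def)
  also have "\<dots> = (\<Sum>f\<in>incr_maps S v T (Ang0 T). Poly_Mapping.single (subst_tree S v f T) 1)"
  proof (rule sum.mono_neutral_cong_right)
    show "finite (incr_maps S v T (Ang T))"
      by (intro finite_incr_maps) (simp add: Ang_def)
    show sub: "incr_maps S v T (Ang0 T) \<subseteq> incr_maps S v T (Ang T)"
      unfolding incr_maps_Ang0 by blast
    show "\<forall>f\<in>incr_maps S v T (Ang T) - incr_maps S v T (Ang0 T).
        Poly_Mapping.single (subst_tree S v f T) (c f) = 0"
      by (simp add: c)
    show "Poly_Mapping.single (subst_tree S v f T) (c f) = Poly_Mapping.single (subst_tree S v f T) 1"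
      if "f \<in> incr_maps S v T (Ang0 T)" for f
      using that subsetD[OF sub that] by (simp add: c)
  qed
  finally show ?thesis using True by simp
next
  case False
  then show ?thesis using T by (simp add: wcomp_def total_weight_def verts_trees)
qed

lemma lin_ext_fst_wcomp_one:
  assumes "T \<in> trees B"
  shows "lin_ext (\<lambda>t. Poly_Mapping.single (fst t) 1) (wcomp (1::'k::field) v (S, W) (T, X)) =
    (if (\<Sum>b\<in>B. X b) = W v
     then \<Sum>f\<in>incr_maps S v T (Ang T). Poly_Mapping.single (subst_tree S v f T) 1 else 0)"
  using assms
  by (simp add: wcomp_def total_weight_def verts_trees subst_wtree_def lin_ext_sum)

section \<open>From basis trees to the products over weight functions\<close>

lemma identify_wtrees_bij_betw: "bij_betw (identify_wtrees A W) (wtree_part A W) (span_of (trees A))"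
  unfolding identify_wtrees_def wtree_part_def
  by (intro lin_ext_bij_betw) (auto simp: bij_betw_def inj_on_def image_def)

text \<open>Every basis tree in the component \<open>x W\<close> carries exactly the weights
  \<open>W\<close>; thus the weight test in \<open>wcomp\<close> becomes a condition on the indices
  of the components.\<close>

lemma keys_product_space:
  assumes x: "x \<in> product_space Npos wtree_part A" and W: "W \<in> A \<rightarrow>\<^sub>E Npos"
    and s: "s \<in> Poly_Mapping.keys (x W)"
  shows "\<exists>S\<in>trees A. s = (S, W)"
proof -
  have "x W \<in> wtree_part A W"
    by (rule bspec[OF conjunct1[OF x[unfolded product_space_def mem_Collect_eq]] W])
  then have "Poly_Mapping.keys (x W) \<subseteq> {(T, W) |T. T \<in> trees A}"
    by (simp add: wtree_part_def span_of_def)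
  from subsetD[OF this s] show ?thesis by auto
qed

text \<open>Everything specific to \<lambda> and to the admissible angles \<open>Q\<close> is in the
  assumption \<open>comp\<close> on two basis trees. The rest follows by linearity and by comparing
  components.\<close>

lemma cp_operad_iso_B_lambda:
  fixes lam :: "'k::field" and Q :: "'v ptree \<Rightarrow> ('v \<times> nat) set"
  assumes comp: "\<And>A v B S T W X. S \<in> trees A \<Longrightarrow> T \<in> trees B \<Longrightarrow> v \<in> A \<Longrightarrow> (A - {v}) \<inter> B = {} \<Longrightarrow>
    W \<in> A \<rightarrow>\<^sub>E Npos \<Longrightarrow> X \<in> B \<rightarrow>\<^sub>E Npos \<Longrightarrow>
    lin_ext (\<lambda>t. Poly_Mapping.single (fst t) 1) (wcomp lam v (S, W) (T, X)) =
    (if (\<Sum>b\<in>B. X b) = W v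
     then \<Sum>f\<in>incr_maps S v T (Q T). Poly_Mapping.single (subst_tree S v f T) 1 else 0)"
  shows "cp_operad_iso identify_wtrees (B_lambda lam) (assoc_cp_operad Npos (tree_operad Q))"
proof -
  let ?\<phi> = "lin_ext (\<lambda>t. Poly_Mapping.single (fst t) (1::'k))
    :: ('v wtree \<Rightarrow>\<^sub>0 'k) \<Rightarrow> ('v ptree \<Rightarrow>\<^sub>0 'k)"
  let ?\<Phi> = "product_map Npos identify_wtrees
    :: 'v set \<Rightarrow> (('v \<Rightarrow> nat) \<Rightarrow> ('v wtree \<Rightarrow>\<^sub>0 'k)) \<Rightarrow> (('v \<Rightarrow> nat) \<Rightarrow> ('v ptree \<Rightarrow>\<^sub>0 'k))"
  have \<Phi>: "?\<Phi> A x W = (if W \<in> A \<rightarrow>\<^sub>E Npos then ?\<phi> (x W) else 0)" for A x W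
    by (simp add: product_map_def identify_wtrees_def)
  let ?P = "product_space Npos wtree_part :: 'v set \<Rightarrow> (('v \<Rightarrow> nat) \<Rightarrow> ('v wtree \<Rightarrow>\<^sub>0 'k)) set"
  let ?g = "\<lambda>v S T. \<Sum>f\<in>incr_maps S v T (Q T). Poly_Mapping.single (subst_tree S v f T) (1::'k)"
  \<comment> \<open>In \<open>?hP\<close> the weight test is made by \<open>wcomp\<close> on the
    trees themselves. Trees on the other side carry no weights, so \<open>?hQ\<close> tests the
    indices, outside the bilinear extension.\<close>
  let ?hP = "\<lambda>v (W::'v \<Rightarrow> nat) (X::'v \<Rightarrow> nat). bilin_ext (wcomp lam v)"
  let ?hQ = "\<lambda>(v::'v) B W X \<alpha> \<beta>. if (\<Sum>b\<in>B. X b) = (W v :: nat) then bilin_ext (?g v) \<alpha> \<beta> else 0"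

  have bij: "bij_betw (?\<Phi> A) (?P A) (product_space Npos (\<lambda>A W. span_of (trees A)) A)" for A
    by (intro product_map_bij_betw identify_wtrees_bij_betw)
  have add: "?\<Phi> A (x + y) = ?\<Phi> A x + ?\<Phi> A y" for A x y
    by (rule ext) (simp add: \<Phi> lin_ext_add)
  have scale: "?\<Phi> A (\<lambda>W. scale c (x W)) = (\<lambda>W. scale c (?\<Phi> A x W))" for A x c
    by (rule ext) (simp add: \<Phi> lin_ext_scale)
  have act: "?\<Phi> A' (product_act Npos A' \<sigma> (lin_ext (\<lambda>(T, W).
        Poly_Mapping.single (relabel (inv_into A' \<sigma>) T, \<lambda>a\<in>A'. W (\<sigma> a)) 1)) x)
     = product_act Npos A' \<sigma> (lin_ext (\<lambda>T. Poly_Mapping.single (relabel (inv_into A' \<sigma>) T) 1)) (?\<Phi> A x)"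
    if \<sigma>: "bij_betw \<sigma> A' A" for A A' \<sigma> x
  proof
    fix W' :: "'v \<Rightarrow> nat"
    have im: "\<sigma> ` A' = A" using \<sigma> by (simp add: bij_betw_def)
    \<comment> \<open>The transported weight function must be admissible on \<open>A\<close>,
      because \<open>?\<Phi> A\<close> puts 0 at every other index.\<close>
    have "(\<lambda>a\<in>A. W' (inv_into A' \<sigma> a)) \<in> A \<rightarrow>\<^sub>E Npos" if "W' \<in> A' \<rightarrow>\<^sub>E Npos"
      using that bij_betwE[OF bij_betw_inv_into[OF \<sigma>]] by (auto simp: PiE_iff)
    then show "?\<Phi> A' (product_act Npos A' \<sigma> (lin_ext (\<lambda>(T, W).
        Poly_Mapping.single (relabel (inv_into A' \<sigma>) T, \<lambda>a\<in>A'. W (\<sigma> a)) 1)) x) W'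
     = product_act Npos A' \<sigma> (lin_ext (\<lambda>T. Poly_Mapping.single (relabel (inv_into A' \<sigma>) T) 1)) (?\<Phi> A x) W'"
      by (simp add: \<Phi> product_act_def im lin_ext_lin_ext case_prod_unfold)
  qed
  have comp': "?\<Phi> ((A - {v}) \<union> B) (product_comp Npos A v B (?hP v) x y)
      = product_comp Npos A v B (?hQ v B) (?\<Phi> A x) (?\<Phi> B y)"
    if "finite A" and v: "v \<in> A" and B: "finite B" "B \<noteq> {}" and AB: "(A - {v}) \<inter> B = {}"
      and x: "x \<in> ?P A" and y: "y \<in> ?P B" for A v B x y
  proof
    fix Z :: "'v \<Rightarrow> nat"
    have keys_x: "\<exists>S\<in>trees A. s = (S, W)" if "W \<in> A \<rightarrow>\<^sub>E Npos" "s \<in> Poly_Mapping.keys (x W)" for s W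
      by (rule keys_product_space[OF x that])
    have keys_y: "\<exists>T\<in>trees B. t = (T, X)" if "X \<in> B \<rightarrow>\<^sub>E Npos" "t \<in> Poly_Mapping.keys (y X)" for t X
      by (rule keys_product_space[OF y that])
    \<comment> \<open>This is the vanishing that \<open>product_comp_inside\<close> asks for on the
      side of \<open>B_lambda\<close>; for \<open>?hQ\<close> it is built into the
      conditional.\<close>
    have h0: "?hP v W X (x W) (y X) = 0"
      if W: "W \<in> A \<rightarrow>\<^sub>E Npos" and X: "X \<in> B \<rightarrow>\<^sub>E Npos" and XW: "(\<Sum>b\<in>B. X b) \<noteq> W v" for W X
    proof (rule bilin_ext_eq_0)
      fix s t assume s: "s \<in> Poly_Mapping.keys (x W)" and t: "t \<in> Poly_Mapping.keys (y X)"
      obtain S where "s = (S, W)" using keys_x[OF W s] by (elim bexE)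
      moreover obtain T where "T \<in> trees B" "t = (T, X)" using keys_y[OF X t] by (elim bexE)
      ultimately show "wcomp lam v s t = 0"
        using XW by (simp add: wcomp_def total_weight_def verts_trees)
    qed
    have hom: "?\<phi> (?hP v W X (x W) (y X)) = ?hQ v B W X (?\<Phi> A x W) (?\<Phi> B y X)"
      if W: "W \<in> A \<rightarrow>\<^sub>E Npos" and X: "X \<in> B \<rightarrow>\<^sub>E Npos" and XW: "(\<Sum>b\<in>B. X b) = W v" for W X
    proof -
      have "?\<phi> (bilin_ext (wcomp lam v) (x W) (y X)) = bilin_ext (\<lambda>s t. ?g v (fst s) (fst t)) (x W) (y X)"
        unfolding lin_ext_bilin_ext
      proof (rule bilin_ext_cong)
        fix s t assume s: "s \<in> Poly_Mapping.keys (x W)" and t: "t \<in> Poly_Mapping.keys (y X)"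
        obtain S where "S \<in> trees A" "s = (S, W)" using keys_x[OF W s] by (elim bexE)
        moreover obtain T where "T \<in> trees B" "t = (T, X)" using keys_y[OF X t] by (elim bexE)
        ultimately show "?\<phi> (wcomp lam v s t) = ?g v (fst s) (fst t)"
          using comp[OF _ _ v AB W X] XW by simp
      qed
      also have "\<dots> = bilin_ext (?g v) (?\<phi> (x W)) (?\<phi> (y X))"
        by (simp add: bilin_ext_basis_maps)
      finally show ?thesis using W X XW by (simp add: \<Phi>)
    qed
    show "?\<Phi> ((A - {v}) \<union> B) (product_comp Npos A v B (?hP v) x y) Z
      = product_comp Npos A v B (?hQ v B) (?\<Phi> A x) (?\<Phi> B y) Z"
    proof (cases "Z \<in> (A - {v}) \<union> B \<rightarrow>\<^sub>E Npos")
      case True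
      have sZ: "(\<Sum>b\<in>B. Z b) \<in> Npos" using True B by (intro sum_Npos) auto
      \<comment> \<open>Both compositions select this same pair \<open>(W0, X0)\<close> at
        \<open>Z\<close>, so the comparison reduces to one bilinear product on each side, which is
        \<open>hom\<close>.\<close>
      define W0 where "W0 = (\<lambda>a\<in>A. if a = v then \<Sum>b\<in>B. Z b else Z a)"
      define X0 where "X0 = restrict Z B"
      note inside = product_comp_inside[where A = A and B = B and Z = Z and v = v, OF True v AB sZ,
          folded W0_def X0_def]
      have "?\<Phi> ((A - {v}) \<union> B) (product_comp Npos A v B (?hP v) x y) Z
          = ?\<phi> (product_comp Npos A v B (?hP v) x y Z)"
        using True by (simp only: \<Phi> if_True)
      also have "product_comp Npos A v B (?hP v) x y Z = ?hP v W0 X0 (x W0) (y X0)"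
        by (rule inside(1)) (fact h0)
      also have "?\<phi> \<dots> = ?hQ v B W0 X0 (?\<Phi> A x W0) (?\<Phi> B y X0)"
        by (rule hom; rule inside(2-4)[where h = "?hP v" and x = x and y = y]) (fact h0)+
      also have "\<dots> = product_comp Npos A v B (?hQ v B) (?\<Phi> A x) (?\<Phi> B y) Z"
        by (rule inside(1)[symmetric]) (simp only: if_False)
      finally show ?thesis .
    next
      case False
      then show ?thesis by (simp add: \<Phi> product_comp_outside)
    qed
  qed
  have unit: "?\<Phi> {v} (\<lambda>W. if W \<in> {v} \<rightarrow>\<^sub>E Npos then Poly_Mapping.single (Node v [], W) 1 else 0)
      = (\<lambda>W. if W \<in> {v} \<rightarrow>\<^sub>E Npos then Poly_Mapping.single (Node v []) 1 else 0)" for v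
    by (rule ext) (simp add: \<Phi>)
  show ?thesis
    unfolding cp_operad_iso_def B_lambda_def assoc_cp_operad_def tree_operad_def Let_def
      operad_data.simps cp_operad_data.simps
    by (intro conjI allI impI ballI refl identify_wtrees_bij_betw bij add scale act comp' unit)
      (elim conjE; assumption)+
qed

theorem mainTheorem4:
  shows "cp_operad_iso identify_wtrees
           (B_lambda 0 :: ('v, nat, 'k::field_char_0, 'v wtree \<Rightarrow>\<^sub>0 'k) cp_operad_data)
           (assoc_cp_operad Npos B_zero)
       \<and> cp_operad_iso identify_wtrees
           (B_lambda 1 :: ('v, nat, 'k::field_char_0, 'v wtree \<Rightarrow>\<^sub>0 'k) cp_operad_data)
           (assoc_cp_operad Npos Brace)"
  unfolding B_zero_def Brace_def
  by (intro conjI cp_operad_iso_B_lambda lin_ext_fst_wcomp_zero lin_ext_fst_wcomp_one)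

end
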